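(* (1) $\chi_{NL}(F_n)=4$ for $4\le n\le 10$. (2) $\chi_{NL}(W_n)=4$ for $n\in\{4,6,8,10\}$. (3) $\chi_{NL}(W_n)=5$ for $n\in\{5,7,9\}$.
   Context: All graphs are finite, simple, undirected and connected. The fan $F_n$ (resp. wheel $W_n$) of order $n$ is obtained from the path $P_{n-1}$ (resp. cycle $C_{n-1}$) of order $n-1$ by adding a new vertex adjacent to every vertex. A $k$-coloring of a graph $G$ is a partition of $V(G)$ into $k$ independent sets (colors). A coloring $\{S_1,\dots,S_k\}$ is neighbor-locating (an NL-coloring) if for any two distinct vertices $u,v$ in the same color class, $\{j: N(u)\cap S_j\neq\emptyset\}\neq\{j: N(v)\cap S_j\neq\emptyset\}$. The neighbor-locating chromatic number $\chi_{NL}(G)$ is the minimum number of colors in an NL-coloring of $G$. *)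

theory Defs
  imports "Graph_Theory.Pair_Digraph" "Graph_Theory.Digraph_Component" "HOL-Library.Disjoint_Sets"
begin

text \<open>
  Finite simple undirected graphs are the digraphs without parallel arcs that satisfy
  \<^locale>\<open>pair_graph\<close>, i.e. an undirected edge is a pair of opposite arcs.
\<close>

definition neighbors :: "'a pair_pre_digraph \<Rightarrow> 'a \<Rightarrow> 'a set" where
  "neighbors G u = {v. (u, v) \<in> parcs G}"

definition independent_set :: "'a pair_pre_digraph \<Rightarrow> 'a set \<Rightarrow> bool" where
  "independent_set G S \<longleftrightarrow> S \<subseteq> pverts G \<and> (\<forall>u\<in>S. \<forall>v\<in>S. (u, v) \<notin> parcs G)"

text \<open>A coloring is the set of its color classes, which are nonempty by \<^const>\<open>partition_on\<close>.\<close>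

definition coloring :: "'a pair_pre_digraph \<Rightarrow> 'a set set \<Rightarrow> bool" where
  "coloring G P \<longleftrightarrow> partition_on (pverts G) P \<and> (\<forall>S\<in>P. independent_set G S)"

definition neighbor_colors :: "'a pair_pre_digraph \<Rightarrow> 'a set set \<Rightarrow> 'a \<Rightarrow> 'a set set" where
  "neighbor_colors G P u = {T \<in> P. neighbors G u \<inter> T \<noteq> {}}"

definition NL_coloring :: "'a pair_pre_digraph \<Rightarrow> 'a set set \<Rightarrow> bool" where
  "NL_coloring G P \<longleftrightarrow> coloring G P \<and>
     (\<forall>S\<in>P. \<forall>u\<in>S. \<forall>v\<in>S. u \<noteq> v \<longrightarrow> neighbor_colors G P u \<noteq> neighbor_colors G P v)"

definition NL_chromatic_number :: "'a pair_pre_digraph \<Rightarrow> nat" where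
  "NL_chromatic_number G = (LEAST k. \<exists>P. NL_coloring G P \<and> card P = k)"

text \<open>
  The minimum is attained for every finite simple graph: the partition into singletons
  is an NL-coloring.
\<close>

lemma (in pair_graph) NL_coloring_singletons: "NL_coloring G ((\<lambda>v. {v}) ` pverts G)"
  by (auto dest: no_loops' simp: NL_coloring_def coloring_def independent_set_def partition_on_def disjoint_def)

lemma (in pair_graph) NL_chromatic_number_attained:
  "\<exists>P. NL_coloring G P \<and> card P = NL_chromatic_number G"
  unfolding NL_chromatic_number_def
  by (rule LeastI_ex) (use NL_coloring_singletons in blast)

definition path_graph :: "nat \<Rightarrow> nat pair_pre_digraph" where
  "path_graph m = \<lparr>pverts = {..<m},
     parcs = {(i, j). i < m \<and> j < m \<and> (j = Suc i \<or> i = Suc j)}\<rparr>"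

text \<open>The cycle is meant for \<open>m \<ge> 3\<close> only.\<close>

definition cycle_graph :: "nat \<Rightarrow> nat pair_pre_digraph" where
  "cycle_graph m = \<lparr>pverts = {..<m},
     parcs = {(i, j). i < m \<and> j < m \<and> (j = Suc i mod m \<or> i = Suc j mod m)}\<rparr>"

text \<open>Adding a new vertex \<^term>\<open>None\<close> adjacent to all vertices of \<open>G\<close>:\<close>

definition cone_graph :: "'a pair_pre_digraph \<Rightarrow> 'a option pair_pre_digraph" where
  "cone_graph G = \<lparr>pverts = insert None (Some ` pverts G),
     parcs = {(Some u, Some v) | u v. (u, v) \<in> parcs G}
       \<union> {(None, Some v) | v. v \<in> pverts G} \<union> {(Some v, None) | v. v \<in> pverts G}\<rparr>"

definition fan_graph :: "nat \<Rightarrow> nat option pair_pre_digraph" where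
  "fan_graph n = cone_graph (path_graph (n - 1))"

definition wheel_graph :: "nat \<Rightarrow> nat option pair_pre_digraph" where
  "wheel_graph n = cone_graph (cycle_graph (n - 1))"

text \<open>All of these are finite simple graphs of the expected order, and connected.\<close>

lemma pair_graph_path: "pair_graph (path_graph m)"
  by unfold_locales
    (auto simp: path_graph_def symmetric_def sym_def
      intro: finite_subset[of _ "{..<m} \<times> {..<m}"])

lemma pair_graph_cycle:
  assumes "m \<ge> 3" shows "pair_graph (cycle_graph m)"
proof
  show "fst e \<noteq> snd e" if "e \<in> parcs (cycle_graph m)" for e
    using that assms by (auto simp: cycle_graph_def mod_Suc split: if_splits)
qed (auto simp: cycle_graph_def symmetric_def sym_def intro: finite_subset[of _ "{..<m} \<times> {..<m}"])

lemma pair_graph_cone: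
  assumes "pair_graph G" shows "pair_graph (cone_graph G)"
proof -
  interpret pair_graph G by fact
  have sub: "fst e \<in> pverts (cone_graph G)" "snd e \<in> pverts (cone_graph G)"
    if "e \<in> parcs (cone_graph G)" for e
    using that by (auto simp: cone_graph_def dest: in_arcsD1 in_arcsD2)
  have fin: "finite (pverts (cone_graph G))"
    by (simp add: cone_graph_def pair_finite_verts)
  have "finite (parcs (cone_graph G))"
    by (rule finite_subset[OF _ finite_cartesian_product[OF fin fin]])
      (auto dest: sub)
  moreover have "symmetric (with_proj (cone_graph G))"
    by (auto simp: symmetric_def sym_def cone_graph_def dest: arcs_symmetric)
  moreover have "fst e \<noteq> snd e" if "e \<in> parcs (cone_graph G)" for e
    using that by (auto simp: cone_graph_def dest: no_loops')
  ultimately show ?thesis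
    using sub fin by unfold_locales auto
qed

lemma connected_cone:
  assumes "pair_graph G" shows "connected (with_proj (cone_graph G))"
proof -
  interpret C: pair_graph "cone_graph G" by (rule pair_graph_cone) fact
  let ?C = "with_proj (cone_graph G)"
  have hub: "None \<in> pverts (cone_graph G)"
    by (simp add: cone_graph_def)
  have adj: "(None, Some x) \<in> parcs (cone_graph G)" "(Some x, None) \<in> parcs (cone_graph G)"
    if "Some x \<in> pverts (cone_graph G)" for x
    using that by (auto simp: cone_graph_def)
  have 1: "None \<rightarrow>\<^sup>*\<^bsub>?C\<^esub> v" if "v \<in> pverts (cone_graph G)" for v
    using that hub adj by (cases v) (auto intro!: C.reachable_adjI)
  have 2: "v \<rightarrow>\<^sup>*\<^bsub>?C\<^esub> None" if "v \<in> pverts (cone_graph G)" for v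
    using that hub adj by (cases v) (auto intro!: C.reachable_adjI)
  have "u \<rightarrow>\<^sup>*\<^bsub>?C\<^esub> v"
    if "u \<in> pverts (cone_graph G)" "v \<in> pverts (cone_graph G)" for u v
    using C.reachable_trans[OF 2 1] that .
  then show ?thesis
    using hub
    by (auto simp: connected_def strongly_connected_def
        C.reachable_mk_symmetric_eq[OF C.pair_sym_arcs])
qed

lemma fan_graph_simple_connected:
  "pair_graph (fan_graph n)" "connected (with_proj (fan_graph n))"
  by (simp_all add: fan_graph_def pair_graph_cone connected_cone pair_graph_path)

lemma wheel_graph_simple_connected:
  assumes "n \<ge> 4"
  shows "pair_graph (wheel_graph n)" "connected (with_proj (wheel_graph n))"
  using assms by (simp_all add: wheel_graph_def pair_graph_cone connected_cone pair_graph_cycle)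

lemma card_pverts_fan_wheel:
  assumes "n \<ge> 1"
  shows "card (pverts (fan_graph n)) = n" "card (pverts (wheel_graph n)) = n"
  using assms
  by (simp_all add: fan_graph_def wheel_graph_def cone_graph_def path_graph_def cycle_graph_def
      card_image)

end

theory Submission
  imports Defs
begin

text \<open>
  The hub of a cone is adjacent to everything, so its color class is a singleton, and deleting it
  turns the NL-colorings of the cone into those of the base; hence a cone needs exactly one color
  more than its base. It remains to color paths and cycles. A vertex is determined by its color
  and the nonempty set of colors around it, which leaves only two vertices if there are at most
  two colors; so paths and cycles need three colors.
  In a cycle of even length three colors do not suffice. Each color class contains at most one
  vertex whose neighbors have different colors. Counting the edges between two color classes from
  either side shows that, modulo 2, all three classes contain the same number of such vertices,
  and that the remaining vertices come in pairs. As the length is even, there are no such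
  vertices at all. But then vertices at distance two have the same color and the same neighboring
  colors.
\<close>

section \<open>Colorings as maps\<close>

text \<open>Colors may be values of any type, so that list entries and \<open>option\<close> values
  can serve as colors; the colors around a vertex become an image under \<open>c\<close>.\<close>

definition NL_map :: "'a pair_pre_digraph \<Rightarrow> ('a \<Rightarrow> 'b) \<Rightarrow> bool" where
  "NL_map G c \<longleftrightarrow> (\<forall>u v. (u, v) \<in> parcs G \<longrightarrow> c u \<noteq> c v) \<and>
     (\<forall>u\<in>pverts G. \<forall>v\<in>pverts G. u \<noteq> v \<longrightarrow> c u = c v \<longrightarrow>
        c ` neighbors G u \<noteq> c ` neighbors G v)"

lemma NL_mapD:
  assumes "NL_map G c"
  shows "(u, v) \<in> parcs G \<Longrightarrow> c u \<noteq> c v"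
    "c u = c v \<Longrightarrow> u \<in> pverts G \<Longrightarrow> v \<in> pverts G \<Longrightarrow>
      c ` neighbors G u = c ` neighbors G v \<Longrightarrow> u = v"
  using assms unfolding NL_map_def by blast+

context pair_graph
begin

lemma neighbors_subset: "neighbors G u \<subseteq> pverts G"
  by (auto simp: neighbors_def dest: in_arcsD2)

text \<open>The color classes are the fibers of \<open>c\<close> over the colors in use. These are
  nonempty and disjoint, so \<open>F\<close> is injective there, and comparing sets of neighboring
  classes amounts to comparing sets of neighboring colors.\<close>

lemma NL_coloring_fibers:
  assumes c: "NL_map G c"
  defines "F \<equiv> \<lambda>x. {v \<in> pverts G. c v = x}"
  shows "NL_coloring G (F ` c ` pverts G)" "card (F ` c ` pverts G) = card (c ` pverts G)"
proof -
  have nc: "neighbor_colors G (F ` c ` pverts G) u = F ` c ` neighbors G u" for u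
  proof -
    have "neighbors G u \<inter> F x \<noteq> {} \<longleftrightarrow> x \<in> c ` neighbors G u" for x
      using neighbors_subset[of u] by (auto simp: F_def)
    then show ?thesis
      using neighbors_subset[of u] unfolding neighbor_colors_def by blast
  qed
  have inj: "inj_on F (c ` pverts G)"
    by (force simp: inj_on_def F_def)
  show "card (F ` c ` pverts G) = card (c ` pverts G)"
    by (rule card_image[OF inj])
  have eq: "F ` c ` neighbors G u = F ` c ` neighbors G v \<longleftrightarrow>
      c ` neighbors G u = c ` neighbors G v" for u v
    by (rule inj_on_image_eq_iff[OF inj]) (use neighbors_subset in blast)+
  have "partition_on (pverts G) (F ` c ` pverts G)"
    by (auto simp: partition_on_def disjoint_def F_def)
  then show "NL_coloring G (F ` c ` pverts G)"
    using NL_mapD[OF c] unfolding NL_coloring_def coloring_def nc eq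
    by (force simp: independent_set_def F_def)
qed

lemma NL_chromatic_number_le:
  assumes "NL_map G c"
  shows "NL_chromatic_number G \<le> card (c ` pverts G)"
  unfolding NL_chromatic_number_def
  by (rule Least_le) (use NL_coloring_fibers[OF assms] in blast)

text \<open>Each vertex is colored by its own class, so the colors are the members of
  \<open>P\<close> and \<open>neighbor_colors\<close> is literally an image of the
  neighborhood.\<close>

lemma NL_map_of_coloring:
  assumes P: "NL_coloring G P"
  obtains c :: "'a \<Rightarrow> 'a set" where "NL_map G c" "c ` pverts G = P"
proof
  let ?c = "\<lambda>v. THE S. S \<in> P \<and> v \<in> S"
  have part: "partition_on (pverts G) P"
    and indep: "\<And>S u v. S \<in> P \<Longrightarrow> u \<in> S \<Longrightarrow> v \<in> S \<Longrightarrow> (u, v) \<notin> parcs G"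
    and loc: "\<And>S u v. S \<in> P \<Longrightarrow> u \<in> S \<Longrightarrow> v \<in> S \<Longrightarrow> u \<noteq> v \<Longrightarrow>
      neighbor_colors G P u \<noteq> neighbor_colors G P v"
    using P by (auto simp: NL_coloring_def coloring_def independent_set_def)
  have c_eq: "?c v = S" if "S \<in> P" "v \<in> S" for v S
    using part that by (intro the_equality) (auto simp: partition_on_def disjoint_def)
  have c_mem: "?c v \<in> P" "v \<in> ?c v" if "v \<in> pverts G" for v
  proof -
    obtain S where "S \<in> P" "v \<in> S"
      using part \<open>v \<in> pverts G\<close> by (auto simp: partition_on_def)
    then show "?c v \<in> P" "v \<in> ?c v"
      using c_eq by auto
  qed
  show "?c ` pverts G = P"
  proof (intro equalityI subsetI)
    fix S assume "S \<in> P"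
    moreover from this have "S \<noteq> {}" "S \<subseteq> pverts G"
      using part by (auto simp: partition_on_def)
    ultimately show "S \<in> ?c ` pverts G"
      using c_eq by blast
  qed (use c_mem in blast)
  have nc: "neighbor_colors G P u = ?c ` neighbors G u" for u
  proof (intro equalityI subsetI)
    fix S assume "S \<in> neighbor_colors G P u"
    then obtain v where "S \<in> P" "v \<in> S" "v \<in> neighbors G u"
      by (auto simp: neighbor_colors_def)
    then show "S \<in> ?c ` neighbors G u"
      using c_eq by blast
  next
    fix S assume "S \<in> ?c ` neighbors G u"
    then obtain v where "v \<in> neighbors G u" "S = ?c v"
      by blast
    then show "S \<in> neighbor_colors G P u"
      using c_mem neighbors_subset unfolding neighbor_colors_def by blast
  qed
  show "NL_map G ?c"
    unfolding NL_map_def nc[symmetric]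
  proof (intro conjI allI impI ballI)
    fix u v assume uv: "(u, v) \<in> parcs G"
    then have "u \<in> ?c u" "v \<in> ?c v" "?c u \<in> P"
      using c_mem in_arcsD1 in_arcsD2 by blast+
    then show "?c u \<noteq> ?c v"
      using indep[of "?c u" u v] uv by auto
  next
    fix u v assume uv: "u \<in> pverts G" "v \<in> pverts G" "u \<noteq> v" "?c u = ?c v"
    then have "v \<in> ?c u"
      using c_mem(2)[of v] by simp
    then show "neighbor_colors G P u \<noteq> neighbor_colors G P v"
      using loc[OF c_mem(1,2)] uv by blast
  qed
qed

lemma NL_map_attained:
  obtains c :: "'a \<Rightarrow> 'a set"
  where "NL_map G c" "card (c ` pverts G) = NL_chromatic_number G"
  using NL_chromatic_number_attained NL_map_of_coloring by metis

section \<open>Counting vertices by color and neighboring colors\<close>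

text \<open>A vertex is determined by its color and the set of colors around it. That set is
  nonempty and omits the vertex's own color, which leaves \<open>2 ^ (k - 1) - 1\<close> choices for
  each of the \<open>k\<close> colors.\<close>

lemma NL_map_card_bound:
  assumes c: "NL_map G c" and nonisolated: "\<And>u. u \<in> pverts G \<Longrightarrow> neighbors G u \<noteq> {}"
  defines "k \<equiv> card (c ` pverts G)"
  shows "card (pverts G) \<le> k * (2 ^ (k - 1) - 1)"
proof -
  let ?T = "SIGMA x:c ` pverts G. Pow (c ` pverts G - {x}) - {{}}"
  have fin: "finite (c ` pverts G)"
    by (simp add: pair_finite_verts)
  have "inj_on (\<lambda>u. (c u, c ` neighbors G u)) (pverts G)"
    using c by (auto simp: inj_on_def NL_map_def)
  moreover have "(\<lambda>u. (c u, c ` neighbors G u)) ` pverts G \<subseteq> ?T"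
  proof (intro image_subsetI)
    fix u assume u: "u \<in> pverts G"
    have "c ` neighbors G u \<subseteq> c ` pverts G - {c u}"
      using NL_mapD(1)[OF c, of u] neighbors_subset[of u] by (force simp: neighbors_def)
    then show "(c u, c ` neighbors G u) \<in> ?T"
      using u nonisolated[OF u] by (intro SigmaI DiffI PowI) auto
  qed
  moreover have "finite ?T"
    using fin by auto
  ultimately have "card (pverts G) \<le> card ?T"
    by (rule card_inj_on_le)
  also have "\<dots> = (\<Sum>x\<in>c ` pverts G. 2 ^ (k - 1) - 1)"
    using fin by (subst card_SigmaI) (auto simp: k_def card_Pow card_Diff_subset)
  finally show ?thesis
    by (simp add: k_def)
qed

text \<open>With 0, 1 and 2 colors the counting bound allows 0, 0 and 2 vertices.\<close>

lemma NL_map_three_colors: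
  assumes "NL_map G c" "\<And>u. u \<in> pverts G \<Longrightarrow> neighbors G u \<noteq> {}" "card (pverts G) \<ge> 3"
  shows "card (c ` pverts G) \<ge> 3"
proof (rule ccontr)
  assume "\<not> ?thesis"
  then consider "card (c ` pverts G) = 0" | "card (c ` pverts G) = 1" | "card (c ` pverts G) = 2"
    by linarith
  then show False
    using NL_map_card_bound[OF assms(1,2)] assms(3) by cases auto
qed

end

section \<open>Cones\<close>

lemma cone_graph_simps:
  "pverts (cone_graph G) = insert None (Some ` pverts G)"
  "(Some u, Some v) \<in> parcs (cone_graph G) \<longleftrightarrow> (u, v) \<in> parcs G"
  "(None, Some v) \<in> parcs (cone_graph G) \<longleftrightarrow> v \<in> pverts G"
  "(Some v, None) \<in> parcs (cone_graph G) \<longleftrightarrow> v \<in> pverts G"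
  "(None, None) \<notin> parcs (cone_graph G)"
  by (auto simp: cone_graph_def)

lemma neighbors_cone_Some:
  "u \<in> pverts G \<Longrightarrow> neighbors (cone_graph G) (Some u) = insert None (Some ` neighbors G u)"
  unfolding neighbors_def by (auto simp: cone_graph_def)

text \<open>The hub's color occurs nowhere else and is seen by every other vertex, so it uses up one
  color and distinguishes no two vertices of the base.\<close>

theorem NL_chromatic_number_cone:
  assumes "pair_graph G"
  shows "NL_chromatic_number (cone_graph G) = Suc (NL_chromatic_number G)"
proof (rule antisym)
  interpret pair_graph G by fact
  interpret C: pair_graph "cone_graph G" by (rule pair_graph_cone) fact
  show "NL_chromatic_number (cone_graph G) \<le> Suc (NL_chromatic_number G)"
  proof -
    obtain c :: "'a \<Rightarrow> 'a set"
      where c: "NL_map G c" "card (c ` pverts G) = NL_chromatic_number G"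
      by (rule NL_map_attained)
    \<comment> \<open>\<open>map_option c\<close> gives the hub the fresh color \<open>None\<close>,
      which is thereby added to the colors around every other vertex.\<close>
    have im: "map_option c ` insert None (Some ` A) = insert None (Some ` c ` A)" for A
      by (auto simp: image_image)
    have eq: "insert None (Some ` A) = insert None (Some ` B) \<longleftrightarrow> A = B" for A B :: "'a set set"
      by auto
    have "(u, v) \<in> parcs (cone_graph G) \<Longrightarrow> map_option c u \<noteq> map_option c v" for u v
      using NL_mapD(1)[OF c(1)] by (cases u; cases v) (auto simp: cone_graph_simps)
    moreover have "map_option c ` neighbors (cone_graph G) u \<noteq> map_option c ` neighbors (cone_graph G) v"
      if "u \<in> pverts (cone_graph G)" "v \<in> pverts (cone_graph G)" "u \<noteq> v"
        "map_option c u = map_option c v" for u v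
      using NL_mapD(2)[OF c(1)] that
      by (cases u; cases v) (auto simp: cone_graph_simps neighbors_cone_Some im eq simp del: image_insert)
    ultimately have "NL_map (cone_graph G) (map_option c)"
      unfolding NL_map_def by blast
    then have "NL_chromatic_number (cone_graph G) \<le> card (map_option c ` pverts (cone_graph G))"
      by (rule C.NL_chromatic_number_le)
    also have "\<dots> = Suc (card (c ` pverts G))"
      by (simp add: cone_graph_simps im card_image pair_finite_verts del: image_insert)
    finally show ?thesis
      by (simp add: c)
  qed
  show "Suc (NL_chromatic_number G) \<le> NL_chromatic_number (cone_graph G)"
  proof -
    obtain c :: "'a option \<Rightarrow> 'a option set"
      where c: "NL_map (cone_graph G) c"
        "card (c ` pverts (cone_graph G)) = NL_chromatic_number (cone_graph G)"
      by (rule C.NL_map_attained)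
    have hub: "c None \<noteq> c (Some v)" if "v \<in> pverts G" for v
      using that by (intro NL_mapD(1)[OF c(1)]) (simp add: cone_graph_simps)
    have "NL_map G (c \<circ> Some)"
      unfolding NL_map_def
    proof (intro conjI ballI allI impI)
      fix u v assume "(u, v) \<in> parcs G"
      then show "(c \<circ> Some) u \<noteq> (c \<circ> Some) v"
        using NL_mapD(1)[OF c(1), of "Some u" "Some v"] by (simp add: cone_graph_simps)
    next
      fix u v assume uv: "u \<in> pverts G" "v \<in> pverts G" "u \<noteq> v" "(c \<circ> Some) u = (c \<circ> Some) v"
      then have "c ` neighbors (cone_graph G) (Some u) \<noteq> c ` neighbors (cone_graph G) (Some v)"
        using NL_mapD(2)[OF c(1), of "Some u" "Some v"] by (auto simp: cone_graph_simps)
      \<comment> \<open>Both sets in the cone are those of the base with the hub's color added, so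
        the difference already occurs in the base.\<close>
      then show "(c \<circ> Some) ` neighbors G u \<noteq> (c \<circ> Some) ` neighbors G v"
        using uv by (auto simp: neighbors_cone_Some image_comp)
    qed
    then have "NL_chromatic_number G \<le> card ((c \<circ> Some) ` pverts G)"
      by (rule NL_chromatic_number_le)
    also have "Suc \<dots> = card (c ` pverts (cone_graph G))"
      using hub by (simp add: cone_graph_simps image_image o_def pair_finite_verts image_iff)
    finally show ?thesis
      by (simp add: c)
  qed
qed

section \<open>Three colors on an even cycle\<close>

lemma cycle_graph_simps:
  "pverts (cycle_graph m) = {..<m}"
  "neighbors (cycle_graph m) i = {j. i < m \<and> j < m \<and> (j = Suc i mod m \<or> i = Suc j mod m)}"
  by (auto simp: cycle_graph_def neighbors_def)

text \<open>Naming a vertex through its predecessor \<open>j\<close> keeps subtraction, and the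
  special case of vertex 0, out of the formula.\<close>

lemma neighbors_cycle_Suc:
  assumes "j < m"
  shows "neighbors (cycle_graph m) (Suc j mod m) = {Suc (Suc j) mod m, j}"
  using assms by (auto simp: cycle_graph_simps mod_Suc split: if_splits)

lemma neighbors_cycle:
  assumes "i < m"
  shows "neighbors (cycle_graph m) i = {Suc i mod m, (i + m - 1) mod m}"
proof -
  \<comment> \<open>The summand \<open>m\<close> makes this the predecessor for \<open>i = 0\<close>
    as well.\<close>
  let ?j = "(i + m - 1) mod m"
  have "Suc ?j mod m = i"
    using assms by (simp add: mod_Suc_eq)
  moreover have "?j < m"
    using assms by simp
  ultimately show ?thesis
    using neighbors_cycle_Suc[of ?j m] by (metis mod_Suc_eq)
qed

lemma NL_map_even_cycle:
  assumes "even m" "m \<ge> 4" and c: "NL_map (cycle_graph m) c"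
  shows "card (c ` {..<m}) \<noteq> 3"
proof
  assume "card (c ` {..<m}) = 3"
  then obtain x y z where xyz: "c ` {..<m} = {x, y, z}" "x \<noteq> y" "x \<noteq> z" "y \<noteq> z"
    by (metis card_3_iff)
  define s where "s = (\<lambda>i. Suc i mod m)"
  define p where "p = (\<lambda>i. (i + m - 1) mod m)"
  have lt: "s i < m" "p i < m" for i
    using \<open>m \<ge> 4\<close> by (auto simp: s_def p_def)
  have ps: "p (s i) = i" "s (p i) = i" if "i < m" for i
  proof -
    show "s (p i) = i"
      using that \<open>m \<ge> 4\<close> by (simp add: s_def p_def mod_Suc_eq)
    show "p (s i) = i"
      using that \<open>m \<ge> 4\<close> by (cases "Suc i = m") (auto simp: s_def p_def)
  qed
  have nb: "neighbors (cycle_graph m) i = {s i, p i}" if "i < m" for i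
    using neighbors_cycle[OF that] by (simp add: s_def p_def)
  have proper: "c (s i) \<noteq> c i" "c (p i) \<noteq> c i" if "i < m" for i
  proof -
    have "(i, s i) \<in> parcs (cycle_graph m)" "(i, p i) \<in> parcs (cycle_graph m)"
      using nb[OF that] by (auto simp: neighbors_def)
    then show "c (s i) \<noteq> c i" "c (p i) \<noteq> c i"
      using NL_mapD(1)[OF c] by metis+
  qed
  have loc: "i = j" if "i < m" "j < m" "c i = c j" "{c (s i), c (p i)} = {c (s j), c (p j)}" for i j
    using NL_mapD(2)[OF c, of i j] that by (simp add: nb cycle_graph_simps(1))
  have col: "c i = x \<or> c i = y \<or> c i = z" if "i < m" for i
    using xyz that by blast
  \<comment> \<open>Stating this for \<open>{a, b, d} = {x, y, z}\<close> covers all orders of the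
    three colors at once.\<close>
  have around: "c (s i) \<in> {b, d} \<and> c (p i) \<in> {b, d}"
    if "{a, b, d} = {x, y, z}" "i < m" "c i = a" for a b d i
  proof -
    have "c (s i) \<in> {a, b, d}" "c (p i) \<in> {a, b, d}"
      using lt xyz(1) that(1) by blast+
    then show ?thesis
      using proper[OF \<open>i < m\<close>] \<open>c i = a\<close> by auto
  qed

  \<comment> \<open>Seen from class \<open>a\<close>, the edges to class \<open>b\<close> go forward
    (\<open>A a b\<close>) or backward (\<open>B a b\<close>). \<open>M\<close> collects the
    vertices whose neighbors agree in color, \<open>R\<close> those whose neighbors differ.\<close>
  define A where "A a b = {i. i < m \<and> c i = a \<and> c (s i) = b}" for a b
  define B where "B a b = {i. i < m \<and> c i = a \<and> c (p i) = b}" for a b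
  define M where "M a b = {i. i < m \<and> c i = a \<and> c (s i) = b \<and> c (p i) = b}" for a b
  define R where "R a = {i. i < m \<and> c i = a \<and> c (s i) \<noteq> c (p i)}" for a
  have fin: "finite (A a b)" "finite (B a b)" "finite (M a b)" "finite (R a)" for a b
    by (auto simp: A_def B_def M_def R_def)
  \<comment> \<open>The map \<open>s\<close> moves from one end of an edge to the other: forward
    edges from \<open>a\<close> are backward edges from \<open>b\<close>.\<close>
  have AB: "card (A a b) = card (B b a)" for a b
    by (rule bij_betw_same_card[of s], rule bij_betwI[where g = p])
      (auto simp: A_def B_def lt ps)
  \<comment> \<open>A vertex of \<open>M a b\<close> carries two edges to class \<open>b\<close>.
    With three colors, a vertex of \<open>R a\<close> sees both other colors and so carries exactly
    one.\<close>
  have count: "card (A a b) + card (B a b) = 2 * card (M a b) + card (R a)"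
    if "{a, b, d} = {x, y, z}" "a \<noteq> b" "a \<noteq> d" "b \<noteq> d" for a b d
  proof -
    have "c (s i) = b \<or> c (p i) = b \<longleftrightarrow> c (s i) = b \<and> c (p i) = b \<or> c (s i) \<noteq> c (p i)"
      if "i < m" "c i = a" for i
      using around[OF \<open>{a, b, d} = _\<close> that] by auto
    then have "A a b \<union> B a b = M a b \<union> R a"
      unfolding A_def B_def M_def R_def by blast
    moreover have "A a b \<inter> B a b = M a b"
      by (auto simp: A_def B_def M_def)
    moreover have "card (M a b \<union> R a) = card (M a b) + card (R a)"
      by (rule card_Un_disjoint) (auto simp: fin M_def R_def)
    ultimately show ?thesis
      using card_Un_Int[of "A a b" "B a b"] fin by simp
  qed
  have M1: "card (M a b) \<le> 1" for a b
    using fin loc by (auto simp: card_le_Suc0_iff_eq M_def)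
  have R1: "card (R a) \<le> 1" for a
  proof -
    have "i = j" if "i \<in> R a" "j \<in> R a" for i j
    proof (rule loc)
      \<comment> \<open>Two distinct colors around a vertex of color \<open>a\<close> must be the
        two colors other than \<open>a\<close>.\<close>
      have "{c (s i), c (p i)} = {x, y, z} - {a}" if "i \<in> R a" for i
        using that proper[of i] col[of i] col[of "s i"] col[of "p i"] lt[of i] xyz
        by (auto simp: R_def)
      then show "{c (s i), c (p i)} = {c (s j), c (p j)}"
        using that by simp
    qed (use that in \<open>auto simp: R_def\<close>)
    then show ?thesis
      using fin by (auto simp: card_le_Suc0_iff_eq)
  qed
  \<comment> \<open>Both classes see the same number of edges between them. As all these
    cardinalities are at most 1, they are the binary digits of
    \<open>2 * card (M a b) + card (R a)\<close>.\<close>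
  have sym: "card (M a b) = card (M b a)" "card (R a) = card (R b)"
    if "{a, b, d} = {x, y, z}" "a \<noteq> b" "a \<noteq> d" "b \<noteq> d" for a b d
  proof -
    have "{b, a, d} = {x, y, z}"
      using that by blast
    then have "2 * card (M a b) + card (R a) = 2 * card (M b a) + card (R b)"
      using count[of a b d] count[of b a d] AB[of a b] AB[of b a] that by simp
    then show "card (M a b) = card (M b a)" "card (R a) = card (R b)"
      using M1[of a b] M1[of b a] R1[of a] R1[of b] by presburger+
  qed
  have cls: "card {i. i < m \<and> c i = a} = card (R a) + card (M a b) + card (M a d)"
    if "{a, b, d} = {x, y, z}" "a \<noteq> b" "a \<noteq> d" "b \<noteq> d" for a b d
  proof -
    have "c (s i) \<noteq> c (p i) \<or> (c (s i) = b \<and> c (p i) = b) \<or> c (s i) = d \<and> c (p i) = d"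
      if "i < m" "c i = a" for i
      using around[OF \<open>{a, b, d} = _\<close> that] by auto
    then have "{i. i < m \<and> c i = a} = (R a \<union> M a b) \<union> M a d"
      unfolding M_def R_def by blast
    also have "card \<dots> = card (R a \<union> M a b) + card (M a d)"
      by (rule card_Un_disjoint) (use fin that in \<open>auto simp: M_def R_def\<close>)
    also have "card (R a \<union> M a b) = card (R a) + card (M a b)"
      by (rule card_Un_disjoint) (use fin that in \<open>auto simp: M_def R_def\<close>)
    finally show ?thesis .
  qed
  have "{..<m} = ({i. i < m \<and> c i = x} \<union> {i. i < m \<and> c i = y}) \<union> {i. i < m \<and> c i = z}"
    using col by auto
  also have "card \<dots> = card ({i. i < m \<and> c i = x} \<union> {i. i < m \<and> c i = y}) + card {i. i < m \<and> c i = z}"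
    by (rule card_Un_disjoint) (use xyz in auto)
  also have "card ({i. i < m \<and> c i = x} \<union> {i. i < m \<and> c i = y}) =
      card {i. i < m \<and> c i = x} + card {i. i < m \<and> c i = y}"
    by (rule card_Un_disjoint) (use xyz in auto)
  finally have "m = card {i. i < m \<and> c i = x} + card {i. i < m \<and> c i = y} + card {i. i < m \<and> c i = z}"
    by simp
  moreover have perm: "{y, x, z} = {x, y, z}" "{z, x, y} = {x, y, z}"
    "{x, z, y} = {x, y, z}" "{y, z, x} = {x, y, z}"
    by auto
  \<comment> \<open>The \<open>M\<close> terms pair up by symmetry, and the three \<open>R\<close>
    terms agree.\<close>
  ultimately have "m = 3 * card (R x) + 2 * (card (M x y) + card (M x z) + card (M y z))"
    using cls[of x y z] cls[of y x z] cls[of z x y]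
      sym[of x y z] sym[of x z y] sym[of y z x] xyz by simp
  then have "even (card (R x))"
    using \<open>even m\<close> by presburger
  then have "card (R x) = 0"
    using R1[of x] by (cases "card (R x)") auto
  then have "card (R a) = 0" if "a \<in> {x, y, z}" for a
    using that sym(2)[of x y z] sym(2)[of x z y] xyz perm by auto
  then have mono: "c (s i) = c (p i)" if "i < m" for i
    using that col[OF that] fin(4) by (auto simp: R_def)
  \<comment> \<open>The neighbors of 1 are 0 and 2, so these share a color. All neighbors of 0 and
    of 2 then have the color of 1, which violates the neighbor-locating condition.\<close>
  have "p 1 = 0" "s 1 = 2" "s 0 = 1" "m > 2"
    using \<open>m \<ge> 4\<close> by (auto simp: p_def s_def)
  moreover have "p 2 = 1"
    using ps(1)[of 1] \<open>s 1 = 2\<close> \<open>m > 2\<close> by simp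
  ultimately have "c 0 = c 2" "c (p 0) = c 1" "c (s 2) = c 1"
    using mono[of 0] mono[of 1] mono[of 2] by auto
  then have "(0::nat) = 2"
    using \<open>p 2 = 1\<close> \<open>s 0 = 1\<close> \<open>m > 2\<close> by (intro loc) auto
  then show False
    by simp
qed

section \<open>Paths and cycles\<close>

lemma path_graph_simps:
  "pverts (path_graph m) = {..<m}"
  "neighbors (path_graph m) i = {j. i < m \<and> j < m \<and> (j = Suc i \<or> i = Suc j)}"
  by (auto simp: path_graph_def neighbors_def)

section \<open>Upper bounds from explicit colorings\<close>

text \<open>An executable form of \<open>NL_map\<close> for a coloring listed vertex by vertex. The
  adjacency is a parameter, so that paths and cycles share the check.\<close>

definition check_NL :: "(nat \<Rightarrow> nat \<Rightarrow> bool) \<Rightarrow> nat list \<Rightarrow> bool" where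
  "check_NL E xs \<longleftrightarrow> (let I = [0..<length xs] in
     (\<forall>i\<in>set I. \<forall>j\<in>set I. (E i j \<longrightarrow> xs ! i \<noteq> xs ! j) \<and>
       (i \<noteq> j \<longrightarrow> xs ! i = xs ! j \<longrightarrow>
         set (map ((!) xs) (filter (E i) I)) \<noteq> set (map ((!) xs) (filter (E j) I)))))"

lemma NL_map_check:
  assumes "check_NL E xs" "pverts G = {..<length xs}"
    "parcs G = {(i, j). i < length xs \<and> j < length xs \<and> E i j}"
  shows "NL_map G ((!) xs)"
proof -
  have "neighbors G i = set (filter (E i) [0..<length xs])" if "i < length xs" for i
    using that assms(3) by (auto simp: neighbors_def)
  then show ?thesis
    using assms unfolding NL_map_def check_NL_def Let_def by auto
qed

lemma card_nth_image: "card ((!) xs ` {..<length xs}) = card (set xs)"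
  by (metis atLeast_upt list.set_map map_nth)

lemma path_NL_le:
  assumes "check_NL (\<lambda>i j. j = Suc i \<or> i = Suc j) xs" "length xs = m"
  shows "NL_chromatic_number (path_graph m) \<le> card (set xs)"
proof -
  interpret pair_graph "path_graph m" by (rule pair_graph_path)
  have "NL_map (path_graph m) ((!) xs)"
    by (rule NL_map_check[OF assms(1)]) (auto simp: assms(2) path_graph_def)
  then show ?thesis
    using NL_chromatic_number_le card_nth_image[of xs] assms(2) by (metis path_graph_simps(1))
qed

lemma cycle_NL_le:
  assumes "check_NL (\<lambda>i j. j = Suc i mod m \<or> i = Suc j mod m) xs" "length xs = m" "m \<ge> 3"
  shows "NL_chromatic_number (cycle_graph m) \<le> card (set xs)"
proof -
  interpret pair_graph "cycle_graph m" by (rule pair_graph_cycle) fact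
  have "NL_map (cycle_graph m) ((!) xs)"
    by (rule NL_map_check[OF assms(1)]) (auto simp: assms(2) cycle_graph_def)
  then show ?thesis
    using NL_chromatic_number_le card_nth_image[of xs] assms(2) by (metis cycle_graph_simps(1))
qed

section \<open>Lower bounds\<close>

lemma path_NL_ge:
  assumes "m \<ge> 3"
  shows "NL_chromatic_number (path_graph m) \<ge> 3"
proof -
  interpret pair_graph "path_graph m" by (rule pair_graph_path)
  obtain c :: "nat \<Rightarrow> nat set" where c: "NL_map (path_graph m) c"
    "card (c ` pverts (path_graph m)) = NL_chromatic_number (path_graph m)"
    by (rule NL_map_attained)
  \<comment> \<open>No vertex is isolated: the end 0 has no predecessor and takes 1 instead.\<close>
  have "(if i = 0 then 1 else i - 1) \<in> neighbors (path_graph m) i" if "i < m" for i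
    using that assms by (auto simp: path_graph_simps)
  then show ?thesis
    using NL_map_three_colors[OF c(1)] c(2) assms unfolding path_graph_simps(1)
    by (metis card_lessThan empty_iff lessThan_iff)
qed

lemma cycle_NL_ge:
  assumes "m \<ge> 3"
  shows "NL_chromatic_number (cycle_graph m) \<ge> (if even m then 4 else 3)"
proof -
  interpret pair_graph "cycle_graph m" by (rule pair_graph_cycle) fact
  obtain c :: "nat \<Rightarrow> nat set" where c: "NL_map (cycle_graph m) c"
    "card (c ` pverts (cycle_graph m)) = NL_chromatic_number (cycle_graph m)"
    by (rule NL_map_attained)
  have "card (c ` pverts (cycle_graph m)) \<ge> 3"
    by (rule NL_map_three_colors[OF c(1)])
      (use assms in \<open>auto simp: cycle_graph_simps(1) neighbors_cycle\<close>)
  \<comment> \<open>An even \<open>m\<close> that is at least 3 is at least 4, as the parity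
    argument requires.\<close>
  moreover have "card (c ` pverts (cycle_graph m)) \<noteq> 3" if "even m"
    using NL_map_even_cycle[OF that _ c(1)] that assms
    by (cases "m = 3") (auto simp: cycle_graph_simps(1))
  ultimately show ?thesis
    using c(2) by auto
qed

section \<open>Exact values\<close>

lemma NL_chromatic_number_path:
  assumes "m \<in> {3..9}"
  shows "NL_chromatic_number (path_graph m) = 3"
proof (rule antisym)
  \<comment> \<open>One witness for each length from 3 to 9. Nine is as far as three colors can
    reach, since the counting bound is then \<open>3 * (2 ^ 2 - 1)\<close>.\<close>
  let ?L = "[[0,1,2], [0,1,0,2], [0,1,0,2,0], [0,1,0,2,1,2], [0,1,0,2,0,2,1],
    [0,1,0,2,0,2,1,2], [0,1,2,1,2,0,2,0,1]] :: nat list list"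
  have "\<forall>m\<in>{3..9}. \<exists>xs\<in>set ?L. length xs = m \<and> card (set xs) = 3"
    by code_simp
  then obtain xs where xs: "xs \<in> set ?L" "length xs = m" "card (set xs) = 3"
    using assms by blast
  have "\<forall>xs\<in>set ?L. check_NL (\<lambda>i j. j = Suc i \<or> i = Suc j) xs"
    by code_simp
  then show "NL_chromatic_number (path_graph m) \<le> 3"
    using xs(1) path_NL_le[OF _ xs(2)] unfolding xs(3) by blast
  show "3 \<le> NL_chromatic_number (path_graph m)"
    using assms by (intro path_NL_ge) auto
qed

lemma NL_chromatic_number_cycle:
  assumes "m \<in> {3..9}"
  shows "NL_chromatic_number (cycle_graph m) = (if even m then 4 else 3)"
proof (rule antisym)
  have "m \<ge> 3"
    using assms by simp
  \<comment> \<open>The witnesses of even length use the fourth color exactly once.\<close>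
  let ?L = "[[0,1,2], [0,1,2,3], [0,1,0,1,2], [0,1,0,1,2,3], [0,1,0,1,2,0,2],
    [0,1,0,1,2,0,1,3], [0,1,0,1,2,1,2,0,2]] :: nat list list"
  have "\<forall>m\<in>{3..9}. \<exists>xs\<in>set ?L. length xs = m \<and> card (set xs) = (if even m then 4 else 3)"
    by code_simp
  then obtain xs where xs: "xs \<in> set ?L" "length xs = m"
    "card (set xs) = (if even m then 4 else 3)"
    using assms by blast
  have "\<forall>xs\<in>set ?L. check_NL (\<lambda>i j. j = Suc i mod length xs \<or> i = Suc j mod length xs) xs"
    by code_simp
  then have "check_NL (\<lambda>i j. j = Suc i mod m \<or> i = Suc j mod m) xs"
    using xs(1) unfolding xs(2)[symmetric] by blast
  then show "NL_chromatic_number (cycle_graph m) \<le> (if even m then 4 else 3)"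
    using cycle_NL_le[OF _ xs(2) \<open>m \<ge> 3\<close>] unfolding xs(3) by blast
  show "(if even m then 4 else 3) \<le> NL_chromatic_number (cycle_graph m)"
    using \<open>m \<ge> 3\<close> by (rule cycle_NL_ge)
qed

theorem theorem19:
  shows "(\<forall>n. 4 \<le> n \<and> n \<le> 10 \<longrightarrow> NL_chromatic_number (fan_graph n) = 4)
    \<and> (\<forall>n\<in>{4, 6, 8, 10}. NL_chromatic_number (wheel_graph n) = 4)
    \<and> (\<forall>n\<in>{5, 7, 9}. NL_chromatic_number (wheel_graph n) = 5)"
proof -
  have fan: "NL_chromatic_number (fan_graph n) = 4" if "4 \<le> n" "n \<le> 10" for n
  proof -
    \<comment> \<open>The order \<open>n\<close> counts the hub, so the path below it has
      \<open>n - 1\<close> vertices.\<close>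
    have "n - 1 \<in> {3..9}"
      using that by auto
    then show ?thesis
      by (simp only: fan_graph_def NL_chromatic_number_cone pair_graph_path NL_chromatic_number_path)
  qed
  \<comment> \<open>The hub shifts the parity: wheels of even order have an odd rim and take 4
    colors, those of odd order take 5.\<close>
  have "NL_chromatic_number (wheel_graph n) = Suc (if even (n - 1) then 4 else 3)"
    if "n \<in> {4..10}" for n
  proof -
    have "n - 1 \<ge> 3" "n - 1 \<in> {3..9}"
      using that by auto
    then show ?thesis
      by (simp only: wheel_graph_def NL_chromatic_number_cone pair_graph_cycle NL_chromatic_number_cycle)
  qed
  with fan show ?thesis
    by auto
qed

end
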